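(* Let $\tau>0$ and $T=\tanh(2\tau)/2$. Let $\Phi^{\mathrm{H}}_{\tau,0}$ be the input-to-state map at time $\tau$ of the Hermite heat equation on the half-line $(0,\infty)$, and $\Phi_{T,0}$ the input-to-state map at time $T$ of the heat equation on $(0,\infty)$, both with Dirichlet $L^2$-control at $x=0$. Then $$\operatorname{Ran}\Phi^{\mathrm{H}}_{\tau,0}=\operatorname{Ran}\Phi_{T,0}.$$
   Context: The Hermite heat equation on the half-line is $\partial_t w-\partial_x^2w+x^2w=0$ for $t>0$, $x\in(0,\infty)$, with $w(t,0)=u_0(t)$ and $w(0,\cdot)=f$; the heat equation on the half-line is $\partial_t w-\partial_x^2w=0$ with the same boundary and initial conditions. The input-to-state map at time $t$ sends a control $u_0\in L^2((0,t);\mathbb{C})$ to the value at time $t$ of the solution with null initial condition $f=0$. Explicitly, for $x\in(0,\infty)$, $$\Phi^{\mathrm{H}}_{\tau,0}u_0(x)=2\int_0^\tau\frac{\partial K}{\partial y}(\tau-s,x,0)\,u_0(s)\,ds,\qquad u_0\in L^2((0,\tau);\mathbb{C}),$$ where $K$ is the Mehler kernel $$K(t,x,y)=\frac{1}{\sqrt{2\pi\sinh(2t)}}\exp\Big(-\coth(2t)\frac{x^2+y^2}{2}+\frac{xy}{\sinh(2t)}\Big),$$ and $$\Phi_{T,0}u_0(x)=\int_0^T\frac{x\,e^{-\frac{x^2}{4(T-\sigma)}}}{2\sqrt{\pi}\,(T-\sigma)^{3/2}}\,u_0(\sigma)\,d\sigma,\qquad u_0\in L^2((0,T);\mathbb{C}).$$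 $\operatorname{Ran}$ denotes the range of each map on the whole corresponding $L^2$ space. *)

theory Defs
  imports "HOL-Analysis.Analysis"
begin

text \<open>
  The set of square-integrable representatives of $L^2((0,t);C)$. Both input-to-state maps below
  are given by Lebesgue integrals of the control, so they take equal values on controls that agree
  almost everywhere on $(0,t)$; the range over representatives is therefore the range over $L^2$.
\<close>

definition L2_controls :: "real \<Rightarrow> (real \<Rightarrow> complex) set" where
  "L2_controls t =
     {u. u \<in> borel_measurable (lebesgue_on {0<..<t}) \<and>
         integrable (lebesgue_on {0<..<t}) (\<lambda>s. (cmod (u s))\<^sup>2)}"

definition mehler_kernel :: "real \<Rightarrow> real \<Rightarrow> real \<Rightarrow> real" where
  "mehler_kernel t x y =
     1 / sqrt (2 * pi * sinh (2 * t)) *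
     exp (- (cosh (2 * t) / sinh (2 * t)) * ((x\<^sup>2 + y\<^sup>2) / 2) + x * y / sinh (2 * t))"

text \<open>
  States are functions on the half-line $(0,\infty)$; the restriction makes them extensional, so
  that equality of states means equality at every point of $(0,\infty)$.
\<close>

definition hermite_input_to_state :: "real \<Rightarrow> (real \<Rightarrow> complex) \<Rightarrow> real \<Rightarrow> complex" where
  "hermite_input_to_state \<tau> u =
     (\<lambda>x\<in>{0<..}. 2 * (LINT s|lebesgue_on {0<..<\<tau>}.
        complex_of_real (deriv (\<lambda>y. mehler_kernel (\<tau> - s) x y) 0) * u s))"

definition heat_input_to_state :: "real \<Rightarrow> (real \<Rightarrow> complex) \<Rightarrow> real \<Rightarrow> complex" where
  "heat_input_to_state T u =
     (\<lambda>x\<in>{0<..}. LINT \<sigma>|lebesgue_on {0<..<T}.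
        complex_of_real
          (x * exp (- x\<^sup>2 / (4 * (T - \<sigma>))) / (2 * sqrt pi * (T - \<sigma>) powr (3 / 2))) * u \<sigma>)"

end

theory Submission
  imports Defs
begin

text \<open>
  The two ranges coincide because the two maps are the same integral operator, seen in different
  time variables and up to an invertible multiplier. The \<open>y\<close>-derivative of the Mehler
  kernel at \<open>y = 0\<close> is
  \[
    \frac{x}{\sqrt{2\pi}\,\sinh(2r)^{3/2}}\, e^{-\coth(2r)x^2/2}, \qquad r = \tau - s,
  \]
  and the Gaussian here is the one of the heat kernel at time \<open>\<rho>\<close>, namely
  \<open>exp (- x\<^sup>2 / (4 * \<rho>))\<close>, exactly when \<open>\<rho> = tanh (2 * r) / 2\<close>. This dictates the
  change of time \<open>\<sigma> = T - tanh (2 * (\<tau> - s)) / 2\<close>, a diffeomorphism of \<open>(0, \<tau>)\<close> onto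
  \<open>(0, T)\<close> with derivative \<open>1 / cosh (2 * r) ^ 2\<close>. After substitution the prefactors
  of the two kernels differ only by \<open>sqrt (cosh (2 * r))\<close>, a function of time alone
  (\<open>kernel_correspondence\<close>). Hence the control \<open>u\<close> on \<open>(0, \<tau>)\<close> steers the Hermite equation to
  the same state as the control \<open>v\<close> on \<open>(0, T)\<close> given by \<open>v \<sigma> = sqrt (cosh (2 * r)) * u s\<close>
  steers the heat equation (\<open>hermite_eq_heat_input_to_state\<close>).

  Both the multiplier and the Jacobian are bounded above and below on the bounded interval
  \<open>(0, \<tau>)\<close>, so \<open>u\<close> is square integrable if and only if \<open>v\<close> is (\<open>L2_controls_iff\<close>), and
  \<open>u \<mapsto> v\<close> is a bijection between the two control spaces. The equality of states is a plain
  substitution because the change of variables formula holds for the Bochner integral of every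
  function: when one of the two integrands is not integrable, neither is the other, and both
  integrals are \<open>0\<close>.
\<close>

section \<open>Change of variables for Lebesgue integrals over sets of reals\<close>

lemma integrable_lebesgue_on_iff_absolutely_integrable_on:
  fixes f :: "'a::euclidean_space \<Rightarrow> 'b::{banach, second_countable_topology}"
  assumes "S \<in> sets lebesgue"
  shows "integrable (lebesgue_on S) f \<longleftrightarrow> f absolutely_integrable_on S"
  using assms by (simp add: integrable_restrict_space set_integrable_def)

context
  fixes g g' :: "real \<Rightarrow> real" and S :: "real set"
  assumes S: "S \<in> sets lebesgue"
    and g': "\<And>s. s \<in> S \<Longrightarrow> (g has_field_derivative g' s) (at s within S)"
    and inj: "inj_on g S"
begin

lemma image_change_of_variables_in_sets_lebesgue: "g ` S \<in> sets lebesgue"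
proof (rule differentiable_image_in_sets_lebesgue [OF S])
  show "g differentiable_on S"
    unfolding differentiable_on_def
    by (meson g' field_differentiable_def field_differentiable_imp_differentiable)
qed simp

lemma integrable_change_of_variables_lebesgue_on:
  fixes f :: "real \<Rightarrow> 'a::euclidean_space"
  shows "integrable (lebesgue_on (g ` S)) f
    \<longleftrightarrow> integrable (lebesgue_on S) (\<lambda>s. \<bar>g' s\<bar> *\<^sub>R f (g s))"
  using absolutely_integrable_change_of_variables_real [OF S g' inj, of f]
  by (simp add: integrable_lebesgue_on_iff_absolutely_integrable_on S
      image_change_of_variables_in_sets_lebesgue)

lemma integral_change_of_variables_lebesgue_on:
  fixes f :: "real \<Rightarrow> 'a::euclidean_space"
  shows "integral\<^sup>L (lebesgue_on (g ` S)) f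
    = integral\<^sup>L (lebesgue_on S) (\<lambda>s. \<bar>g' s\<bar> *\<^sub>R f (g s))"
proof (cases "integrable (lebesgue_on (g ` S)) f")
  case True
  note gS = image_change_of_variables_in_sets_lebesgue
  have True': "integrable (lebesgue_on S) (\<lambda>s. \<bar>g' s\<bar> *\<^sub>R f (g s))"
    using True integrable_change_of_variables_lebesgue_on by blast
  have "integral (g ` S) f = integral S (\<lambda>s. \<bar>g' s\<bar> *\<^sub>R f (g s))"
    using has_absolute_integral_change_of_variables_real [OF S g' inj, of f] True True' S gS
    by (metis integrable_lebesgue_on_iff_absolutely_integrable_on)
  then show ?thesis
    using lebesgue_integral_eq_integral [OF True gS] lebesgue_integral_eq_integral [OF True' S]
    by simp
next
  case False
  then show ?thesis
    using integrable_change_of_variables_lebesgue_on not_integrable_integral_eq by metis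
qed

end

text \<open>
  Continuity alone does not make composition with a map preserve Lebesgue measurability, since the
  preimage of a null set need not be measurable. A differentiable inverse suffices: preimages under
  the map are images under the inverse, and differentiable maps preserve Lebesgue sets.
\<close>

lemma measurable_lebesgue_on_differentiable_inverse:
  fixes g h :: "real \<Rightarrow> real"
  assumes A: "A \<in> sets lebesgue" and B: "B \<in> sets lebesgue"
    and gA: "\<And>s. s \<in> A \<Longrightarrow> g s \<in> B" and hB: "\<And>s. s \<in> B \<Longrightarrow> h s \<in> A"
    and hg: "\<And>s. s \<in> A \<Longrightarrow> h (g s) = s" and gh: "\<And>s. s \<in> B \<Longrightarrow> g (h s) = s"
    and h: "h differentiable_on B"
  shows "g \<in> measurable (lebesgue_on A) (lebesgue_on B)"
proof (rule measurableI)
  fix X assume X: "X \<in> sets (lebesgue_on B)"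
  have XB: "X \<subseteq> B"
    using sets.sets_into_space [OF X] by simp
  have "g -` X \<inter> A = h ` X"
  proof (rule set_eqI)
    fix s show "s \<in> g -` X \<inter> A \<longleftrightarrow> s \<in> h ` X"
      using XB hg gh hB by (metis IntD1 IntD2 IntI image_iff subsetD vimage_eq)
  qed
  moreover have "h ` X \<in> sets lebesgue"
    using X XB B h
    by (intro differentiable_image_in_sets_lebesgue)
      (auto simp: sets_restrict_space_iff intro: differentiable_on_subset)
  ultimately show "g -` X \<inter> space (lebesgue_on A) \<in> sets (lebesgue_on A)"
    using A by (auto simp: sets_restrict_space_iff)
qed (use gA in auto)

section \<open>The change of time\<close>

text \<open>
  The heat time \<open>\<sigma> = T - tanh (2 * (\<tau> - s)) / 2\<close> that corresponds to the Hermite time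
  \<open>s\<close>, with \<open>T = tanh (2 * \<tau>) / 2\<close>: the remaining times \<open>r = \<tau> - s\<close> and
  \<open>\<rho> = T - \<sigma>\<close> satisfy \<open>1 / (4 * \<rho>) = coth (2 * r) / 2\<close>.
\<close>

definition heat_time :: "real \<Rightarrow> real \<Rightarrow> real" where
  "heat_time \<tau> s = (tanh (2 * \<tau>) - tanh (2 * (\<tau> - s))) / 2"

definition hermite_time :: "real \<Rightarrow> real \<Rightarrow> real" where
  "hermite_time \<tau> \<sigma> = \<tau> - artanh (tanh (2 * \<tau>) - 2 * \<sigma>) / 2"

lemma tanh_artanh_real: "tanh (artanh x) = x" if "-1 < x" "x < 1" for x :: real
proof -
  have "tanh (artanh x) = tanh (ln ((1 + x) / (1 - x)) / 2)"
    by (simp add: artanh_def)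
  also have "ln ((1 + x) / (1 - x)) / 2 = ln (sqrt ((1 + x) / (1 - x)))"
    using that by (simp add: ln_sqrt)
  also have "tanh \<dots> = x"
    using that by (subst tanh_ln_real) (auto simp: field_simps)
  finally show ?thesis .
qed

lemma hermite_time_heat_time [simp]: "hermite_time \<tau> (heat_time \<tau> s) = s"
proof -
  have "tanh (2 * \<tau>) - 2 * heat_time \<tau> s = tanh (2 * (\<tau> - s))"
    by (simp add: heat_time_def del: right_diff_distrib_numeral)
  then show ?thesis
    by (simp add: hermite_time_def artanh_tanh_real del: right_diff_distrib_numeral)
qed

lemma heat_time_hermite_time:
  assumes "\<sigma> \<in> {0<..<tanh (2 * \<tau>) / 2}"
  shows "heat_time \<tau> (hermite_time \<tau> \<sigma>) = \<sigma>"
  using assms tanh_real_lt_1 [of "2 * \<tau>"]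
  by (simp add: hermite_time_def heat_time_def tanh_artanh_real)

lemma heat_time_in: "heat_time \<tau> s \<in> {0<..<tanh (2 * \<tau>) / 2}" if "s \<in> {0<..<\<tau>}"
  using that by (auto simp: heat_time_def)

lemma hermite_time_in: "hermite_time \<tau> \<sigma> \<in> {0<..<\<tau>}" if "\<sigma> \<in> {0<..<tanh (2 * \<tau>) / 2}"
proof -
  have "tanh (2 * (\<tau> - hermite_time \<tau> \<sigma>)) = tanh (2 * \<tau>) - 2 * \<sigma>"
    using heat_time_hermite_time [OF that] by (simp add: heat_time_def field_simps)
  then have "tanh 0 < tanh (2 * (\<tau> - hermite_time \<tau> \<sigma>))"
    and "tanh (2 * (\<tau> - hermite_time \<tau> \<sigma>)) < tanh (2 * \<tau>)"
    using that by auto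
  then show ?thesis
    by (simp only: tanh_real_less_iff) simp
qed

lemma inj_on_heat_time: "inj_on (heat_time \<tau>) S"
  by (rule inj_on_inverseI [where g = "hermite_time \<tau>"]) simp

lemma heat_time_image: "heat_time \<tau> ` {0<..<\<tau>} = {0<..<tanh (2 * \<tau>) / 2}"
proof (intro subset_antisym subsetI)
  fix \<sigma> assume "\<sigma> \<in> {0<..<tanh (2 * \<tau>) / 2}"
  then show "\<sigma> \<in> heat_time \<tau> ` {0<..<\<tau>}"
    using heat_time_hermite_time hermite_time_in by (metis imageI)
qed (use heat_time_in in blast)

lemma heat_time_has_field_derivative:
  "(heat_time \<tau> has_field_derivative 1 / (cosh (2 * (\<tau> - s)))\<^sup>2) (at s within S)"
proof -
  have "1 - (tanh (2 * (\<tau> - s)))\<^sup>2 = 1 / (cosh (2 * (\<tau> - s)))\<^sup>2"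
    using hyperbolic_pythagoras [of "2 * (\<tau> - s)"] cosh_real_nonzero [of "2 * (\<tau> - s)"]
    by (simp add: tanh_def power_divide diff_divide_distrib [symmetric] diff_divide_eq_iff
        del: right_diff_distrib_numeral)
  moreover have "(heat_time \<tau> has_field_derivative 1 - (tanh (2 * (\<tau> - s)))\<^sup>2) (at s within S)"
    unfolding heat_time_def by (auto intro!: derivative_eq_intros)
  ultimately show ?thesis
    by simp
qed

lemma measurable_heat_time:
  "heat_time \<tau> \<in> measurable (lebesgue_on {0<..<\<tau>}) (lebesgue_on {0<..<tanh (2 * \<tau>) / 2})"
proof (rule measurable_lebesgue_on_differentiable_inverse [where h = "hermite_time \<tau>"])
  show "hermite_time \<tau> differentiable_on {0<..<tanh (2 * \<tau>) / 2}"
    unfolding differentiable_on_def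
  proof
    fix \<sigma> assume \<sigma>: "\<sigma> \<in> {0<..<tanh (2 * \<tau>) / 2}"
    have "\<bar>tanh (2 * \<tau>) - 2 * \<sigma>\<bar> < 1"
      using \<sigma> tanh_real_lt_1 [of "2 * \<tau>"] by auto
    then have "(tanh (2 * \<tau>) - 2 * \<sigma>)\<^sup>2 < 1"
      by (simp add: abs_square_less_1)
    with \<open>\<bar>tanh (2 * \<tau>) - 2 * \<sigma>\<bar> < 1\<close>
    have "(hermite_time \<tau> has_field_derivative 1 / (1 - (tanh (2 * \<tau>) - 2 * \<sigma>)\<^sup>2))
        (at \<sigma> within {0<..<tanh (2 * \<tau>) / 2})"
      unfolding hermite_time_def
      by (auto intro!: derivative_eq_intros DERIV_chain2 [OF artanh_real_has_field_derivative]
          simp: divide_simps)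
    then show "hermite_time \<tau> differentiable at \<sigma> within {0<..<tanh (2 * \<tau>) / 2}"
      by (meson field_differentiable_def field_differentiable_imp_differentiable)
  qed
qed (auto simp del: greaterThanLessThan_iff
      intro: heat_time_in hermite_time_in heat_time_hermite_time)

lemma measurable_hermite_time:
  "hermite_time \<tau> \<in> measurable (lebesgue_on {0<..<tanh (2 * \<tau>) / 2}) (lebesgue_on {0<..<\<tau>})"
proof (rule measurable_lebesgue_on_differentiable_inverse [where h = "heat_time \<tau>"])
  show "heat_time \<tau> differentiable_on {0<..<\<tau>}"
    unfolding differentiable_on_def
    by (meson field_differentiable_def field_differentiable_imp_differentiable
        heat_time_has_field_derivative)
qed (auto simp del: greaterThanLessThan_iff
      intro: heat_time_in hermite_time_in heat_time_hermite_time)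

section \<open>Correspondence of kernels and controls\<close>

lemma deriv_mehler_kernel:
  "deriv (\<lambda>y. mehler_kernel t x y) 0
    = 1 / sqrt (2 * pi * sinh (2 * t)) * exp (- (cosh (2 * t) / sinh (2 * t)) * (x\<^sup>2 / 2))
      * (x / sinh (2 * t))"
proof (rule DERIV_imp_deriv)
  \<comment> \<open>With parameters in place of the quotients, the case \<open>sinh (2 * t) = 0\<close> is not special.\<close>
  have "((\<lambda>y. a * ((x\<^sup>2 + y\<^sup>2) / 2) + x * y * b) has_field_derivative x * b) (at 0)" for a b
    by (auto intro!: derivative_eq_intros)
  from this [of "- (cosh (2 * t) / sinh (2 * t))" "1 / sinh (2 * t)"]
  have "((\<lambda>y. - (cosh (2 * t) / sinh (2 * t)) * ((x\<^sup>2 + y\<^sup>2) / 2) + x * y / sinh (2 * t))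
      has_field_derivative x / sinh (2 * t)) (at 0)"
    by simp
  from DERIV_cmult [OF DERIV_chain2 [OF DERIV_exp this], of "1 / sqrt (2 * pi * sinh (2 * t))"]
  show "((\<lambda>y. mehler_kernel t x y) has_field_derivative
      1 / sqrt (2 * pi * sinh (2 * t)) * exp (- (cosh (2 * t) / sinh (2 * t)) * (x\<^sup>2 / 2))
      * (x / sinh (2 * t))) (at 0)"
    by (simp add: mehler_kernel_def)
qed

text \<open>
  The factor \<open>1 / (cosh (2 * r))\<^sup>2\<close> is the Jacobian of the change of time; with it, the
  power \<open>3 / 2\<close> of \<open>cosh (2 * r)\<close> produced by \<open>\<rho> powr (3 / 2)\<close> leaves
  \<open>1 / sqrt (cosh (2 * r))\<close>, which the multiplier cancels.
\<close>

lemma kernel_correspondence: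
  fixes r x :: real
  assumes "r > 0"
  defines "\<rho> \<equiv> tanh (2 * r) / 2"
  shows "2 * deriv (\<lambda>y. mehler_kernel r x y) 0
    = 1 / (cosh (2 * r))\<^sup>2 * (x * exp (- x\<^sup>2 / (4 * \<rho>)) / (2 * sqrt pi * \<rho> powr (3 / 2)))
      * sqrt (cosh (2 * r))"
proof -
  define p q where "p = sqrt (sinh (2 * r))" and "q = sqrt (cosh (2 * r))"
  have p: "p > 0" "sinh (2 * r) = p * p" and q: "q > 0" "cosh (2 * r) = q * q"
    using assms by (simp_all add: p_def q_def)
  have \<rho>: "\<rho> = p * p / (2 * (q * q))"
    by (simp add: \<rho>_def tanh_def p q)
  have "\<rho> > 0"
    using p q by (simp add: \<rho>)
  then have "\<rho> powr (3 / 2) = \<rho> * \<rho> powr (1 / 2)"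
    using powr_add [of \<rho> 1 "1 / 2"] by simp
  also have "\<dots> = \<rho> * sqrt \<rho>"
    using \<open>\<rho> > 0\<close> by (simp add: powr_half_sqrt)
  also have "sqrt \<rho> = p / (sqrt 2 * q)"
    using p q by (simp add: \<rho> real_sqrt_divide real_sqrt_mult)
  finally have \<rho>_powr: "\<rho> powr (3 / 2) = \<rho> * (p / (sqrt 2 * q))" .
  have gauss: "- x\<^sup>2 / (4 * \<rho>) = - (cosh (2 * r) / sinh (2 * r)) * (x\<^sup>2 / 2)"
    using p q by (simp add: \<rho> p q field_simps)
  define e where "e = exp (- (cosh (2 * r) / sinh (2 * r)) * (x\<^sup>2 / 2))"
  have two: "sqrt 2 * sqrt 2 = (2::real)"
    by simp
  have "2 * (1 / sqrt (2 * pi * sinh (2 * r)) * e * (x / sinh (2 * r)))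
      = 2 * e * x / (sqrt 2 * sqrt pi * p * (p * p))"
    using p by (simp add: real_sqrt_mult)
  also have "\<dots> = sqrt 2 * e * x / (sqrt pi * p * (p * p))"
    using p two by (simp add: field_simps)
  also have "\<dots> = 1 / (q * q)\<^sup>2 * (x * e / (2 * sqrt pi * (\<rho> * (p / (sqrt 2 * q))))) * q"
    using p q by (simp add: \<rho> field_simps power2_eq_square)
  finally show ?thesis
    unfolding deriv_mehler_kernel gauss \<rho>_powr e_def [symmetric] q_def [symmetric]
    by (simp add: q)
qed

lemma hermite_eq_heat_input_to_state:
  fixes u v :: "real \<Rightarrow> complex"
  assumes uv: "\<And>s. s \<in> {0<..<\<tau>} \<Longrightarrow> v (heat_time \<tau> s) = sqrt (cosh (2 * (\<tau> - s))) * u s"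
  shows "hermite_input_to_state \<tau> u = heat_input_to_state (tanh (2 * \<tau>) / 2) v"
proof -
  let ?T = "tanh (2 * \<tau>) / 2"
  have "2 * (LINT s|lebesgue_on {0<..<\<tau>}.
          complex_of_real (deriv (\<lambda>y. mehler_kernel (\<tau> - s) x y) 0) * u s)
      = (LINT \<sigma>|lebesgue_on {0<..<?T}.
          complex_of_real
            (x * exp (- x\<^sup>2 / (4 * (?T - \<sigma>))) / (2 * sqrt pi * (?T - \<sigma>) powr (3 / 2))) * v \<sigma>)"
    (is "_ = (LINT \<sigma>|_. complex_of_real (?k \<sigma>) * v \<sigma>)") for x
  proof -
    have "(LINT \<sigma>|lebesgue_on {0<..<?T}. complex_of_real (?k \<sigma>) * v \<sigma>)
        = (LINT s|lebesgue_on {0<..<\<tau>}. \<bar>1 / (cosh (2 * (\<tau> - s)))\<^sup>2\<bar> *\<^sub>R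
            (complex_of_real (?k (heat_time \<tau> s)) * v (heat_time \<tau> s)))"
      unfolding heat_time_image [symmetric]
      by (intro integral_change_of_variables_lebesgue_on heat_time_has_field_derivative
          inj_on_heat_time) simp
    also have "\<dots> = (LINT s|lebesgue_on {0<..<\<tau>}.
        2 * (complex_of_real (deriv (\<lambda>y. mehler_kernel (\<tau> - s) x y) 0) * u s))"
    proof (rule Bochner_Integration.integral_cong [OF refl])
      fix s assume "s \<in> space (lebesgue_on {0<..<\<tau>})"
      then have s: "s \<in> {0<..<\<tau>}"
        by simp
      have \<rho>: "?T - heat_time \<tau> s = tanh (2 * (\<tau> - s)) / 2"
        by (simp add: heat_time_def field_simps)
      have "complex_of_real (2 * deriv (\<lambda>y. mehler_kernel (\<tau> - s) x y) 0)
          = complex_of_real (1 / (cosh (2 * (\<tau> - s)))\<^sup>2 * ?k (heat_time \<tau> s)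
              * sqrt (cosh (2 * (\<tau> - s))))"
        unfolding \<rho> using s by (subst kernel_correspondence) auto
      then show "\<bar>1 / (cosh (2 * (\<tau> - s)))\<^sup>2\<bar> *\<^sub>R
            (complex_of_real (?k (heat_time \<tau> s)) * v (heat_time \<tau> s))
          = 2 * (complex_of_real (deriv (\<lambda>y. mehler_kernel (\<tau> - s) x y) 0) * u s)"
        unfolding uv [OF s] scaleR_conv_of_real by (simp add: algebra_simps)
    qed
    finally show ?thesis
      by simp
  qed
  then show ?thesis
    unfolding hermite_input_to_state_def heat_input_to_state_def by simp
qed

lemma integrable_continuous_mult_lebesgue_on:
  fixes c f :: "real \<Rightarrow> real"
  assumes c: "continuous_on {a..b} c" and f: "integrable (lebesgue_on {a<..<b}) f"
  shows "integrable (lebesgue_on {a<..<b}) (\<lambda>s. c s * f s)"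
proof -
  have "compact (c ` {a..b})"
    using c by (intro compact_continuous_image) auto
  then obtain M where M: "\<And>s. s \<in> {a..b} \<Longrightarrow> \<bar>c s\<bar> \<le> M"
    using compact_imp_bounded [of "c ` {a..b}"] by (fastforce simp: bounded_iff)
  have [measurable]: "c \<in> borel_measurable (lebesgue_on {a<..<b})"
    using c by (intro continuous_imp_measurable_on_sets_lebesgue)
      (auto intro: continuous_on_subset)
  show ?thesis
  proof (rule Bochner_Integration.integrable_bound)
    show "integrable (lebesgue_on {a<..<b}) (\<lambda>s. M * f s)"
      using f by simp
    show "AE s in lebesgue_on {a<..<b}. norm (c s * f s) \<le> norm (M * f s)"
    proof (rule AE_I2)
      fix s assume "s \<in> space (lebesgue_on {a<..<b})"
      then have "\<bar>c s\<bar> \<le> \<bar>M\<bar>"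
        using M [of s] by auto
      then show "norm (c s * f s) \<le> norm (M * f s)"
        by (simp add: abs_mult mult_right_mono)
    qed
  qed (use f in measurable)
qed

text \<open>
  Square integrability of \<open>v\<close> on \<open>(0, T)\<close> amounts, after substitution, to that of \<open>u\<close> on
  \<open>(0, \<tau>)\<close> with the weight \<open>1 / cosh (2 * (\<tau> - s))\<close>: the squared multiplier times the Jacobian.
\<close>

lemma L2_controls_iff:
  fixes u v :: "real \<Rightarrow> complex"
  assumes uv: "\<And>s. s \<in> {0<..<\<tau>} \<Longrightarrow> v (heat_time \<tau> s) = sqrt (cosh (2 * (\<tau> - s))) * u s"
  shows "u \<in> L2_controls \<tau> \<longleftrightarrow> v \<in> L2_controls (tanh (2 * \<tau>) / 2)"
proof -
  let ?T = "tanh (2 * \<tau>) / 2" and ?c = "\<lambda>s. cosh (2 * (\<tau> - s))"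
  let ?w = "\<lambda>s. complex_of_real (sqrt (?c s))"
  let ?L = "lebesgue_on {0<..<\<tau>}" and ?L' = "lebesgue_on {0<..<?T}"
  have [measurable]: "?w \<in> borel_measurable ?L"
    by (intro continuous_imp_measurable_on_sets_lebesgue continuous_intros) auto
  have u_eq: "u s = v (heat_time \<tau> s) / ?w s" if "s \<in> {0<..<\<tau>}" for s
    using uv [OF that] by simp
  have "u \<in> borel_measurable ?L \<longleftrightarrow> v \<in> borel_measurable ?L'"
  proof
    assume [measurable]: "u \<in> borel_measurable ?L"
    have "(\<lambda>\<sigma>. ?w (hermite_time \<tau> \<sigma>) * u (hermite_time \<tau> \<sigma>)) \<in> borel_measurable ?L'"
      by (rule measurable_compose [OF measurable_hermite_time, where g = "\<lambda>s. ?w s * u s"])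
        measurable
    then show "v \<in> borel_measurable ?L'"
    proof (rule measurable_cong [THEN iffD1, rotated])
      fix \<sigma> assume "\<sigma> \<in> space ?L'"
      then have "\<sigma> \<in> {0<..<?T}"
        by simp
      then show "?w (hermite_time \<tau> \<sigma>) * u (hermite_time \<tau> \<sigma>) = v \<sigma>"
        using uv [OF hermite_time_in] heat_time_hermite_time by metis
    qed
  next
    assume [measurable]: "v \<in> borel_measurable ?L'"
    have [measurable]: "(\<lambda>s. v (heat_time \<tau> s)) \<in> borel_measurable ?L"
      by (rule measurable_compose [OF measurable_heat_time]) measurable
    have "(\<lambda>s. v (heat_time \<tau> s) / ?w s) \<in> borel_measurable ?L"
      by measurable
    then show "u \<in> borel_measurable ?L"
      by (rule measurable_cong [THEN iffD1, rotated]) (use u_eq in auto)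
  qed
  moreover have "integrable ?L' (\<lambda>\<sigma>. (cmod (v \<sigma>))\<^sup>2) \<longleftrightarrow> integrable ?L (\<lambda>s. (cmod (u s))\<^sup>2)"
  proof -
    have "integrable ?L' (\<lambda>\<sigma>. (cmod (v \<sigma>))\<^sup>2)
        \<longleftrightarrow> integrable ?L (\<lambda>s. \<bar>1 / (?c s)\<^sup>2\<bar> *\<^sub>R (cmod (v (heat_time \<tau> s)))\<^sup>2)"
      unfolding heat_time_image [symmetric]
      by (intro integrable_change_of_variables_lebesgue_on heat_time_has_field_derivative
          inj_on_heat_time) simp
    also have "\<dots> \<longleftrightarrow> integrable ?L (\<lambda>s. 1 / ?c s * (cmod (u s))\<^sup>2)"
    proof (rule Bochner_Integration.integrable_cong [OF refl])
      fix s assume "s \<in> space ?L"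
      then have "s \<in> {0<..<\<tau>}"
        by simp
      then show "\<bar>1 / (?c s)\<^sup>2\<bar> *\<^sub>R (cmod (v (heat_time \<tau> s)))\<^sup>2 = 1 / ?c s * (cmod (u s))\<^sup>2"
        by (simp add: uv norm_mult power_mult_distrib)
          (simp add: power2_eq_square)
    qed
    also have "\<dots> \<longleftrightarrow> integrable ?L (\<lambda>s. (cmod (u s))\<^sup>2)"
    proof
      assume "integrable ?L (\<lambda>s. 1 / ?c s * (cmod (u s))\<^sup>2)"
      then have "integrable ?L (\<lambda>s. ?c s * (1 / ?c s * (cmod (u s))\<^sup>2))"
        by (intro integrable_continuous_mult_lebesgue_on [where c = ?c] continuous_intros)
      then show "integrable ?L (\<lambda>s. (cmod (u s))\<^sup>2)"
        by simp
    next
      assume "integrable ?L (\<lambda>s. (cmod (u s))\<^sup>2)"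
      then show "integrable ?L (\<lambda>s. 1 / ?c s * (cmod (u s))\<^sup>2)"
        by (intro integrable_continuous_mult_lebesgue_on continuous_intros) auto
    qed
    finally show ?thesis .
  qed
  ultimately show ?thesis
    by (simp add: L2_controls_def)
qed

section \<open>Equality of the ranges\<close>

theorem theorem4:
  fixes \<tau> T :: real
  assumes "\<tau> > 0"
    and "T = tanh (2 * \<tau>) / 2"
  shows "hermite_input_to_state \<tau> ` L2_controls \<tau> = heat_input_to_state T ` L2_controls T"
proof (intro subset_antisym image_subsetI)
  let ?w = "\<lambda>s. complex_of_real (sqrt (cosh (2 * (\<tau> - s))))"
  fix u assume u: "u \<in> L2_controls \<tau>"
  define v where "v \<sigma> = ?w (hermite_time \<tau> \<sigma>) * u (hermite_time \<tau> \<sigma>)" for \<sigma>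
  have uv: "v (heat_time \<tau> s) = ?w s * u s" for s
    by (simp add: v_def)
  have "v \<in> L2_controls T"
    using L2_controls_iff [of \<tau> v u] uv u assms(2) by blast
  moreover have "hermite_input_to_state \<tau> u = heat_input_to_state T v"
    using hermite_eq_heat_input_to_state [of \<tau> v u] uv assms(2) by blast
  ultimately show "hermite_input_to_state \<tau> u \<in> heat_input_to_state T ` L2_controls T"
    by blast
next
  let ?w = "\<lambda>s. complex_of_real (sqrt (cosh (2 * (\<tau> - s))))"
  fix v assume v: "v \<in> L2_controls T"
  define u where "u s = v (heat_time \<tau> s) / ?w s" for s
  have uv: "v (heat_time \<tau> s) = ?w s * u s" for s
    by (simp add: u_def)
  have "u \<in> L2_controls \<tau>"
    using L2_controls_iff [of \<tau> v u] uv v assms(2) by blast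
  moreover have "hermite_input_to_state \<tau> u = heat_input_to_state T v"
    using hermite_eq_heat_input_to_state [of \<tau> v u] uv assms(2) by blast
  ultimately show "heat_input_to_state T v \<in> hermite_input_to_state \<tau> ` L2_controls \<tau>"
    by (metis imageI)
qed

end
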